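(* Let $a,b\ge 1$ be integers, let $m=2^{a}3^{b}-1$ and $p=3m(m+1)+1$, and suppose that $p$ is prime. Then the following are equivalent: (i) $w_3=7$ is a valid Pocklington witness for $p$ at the prime $q=3$; (ii) $m\not\equiv 2\pmod 7$; (iii) $(a\bmod 3,\ b\bmod 6)\notin\{(0,1),(1,5),(2,3)\}$.
   Context: For $q\in\{2,3\}$ and $p=3m(m+1)+1$ with $m=2^a3^b-1$ (so that $6\mid p-1$), an integer $w$ is a valid Pocklington witness for $p$ at $q$ if $w^{p-1}\equiv 1\pmod p$ and $\gcd(w^{(p-1)/q}-1,\,p)=1$. For $p$ prime, a number $w$ coprime to $p$ is valid at $q=3$ exactly when $w$ is a cubic non-residue modulo $p$ (i.e. not congruent to a cube modulo $p$). Here $a\bmod 3\in\{0,1,2\}$ and $b\bmod 6\in\{0,\dots,5\}$ denote the least non-negative residues. *)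

theory Defs
  imports "HOL-Number_Theory.Cong" "HOL-Computational_Algebra.Primes"
begin

text \<open>
  The quotient (p - 1) div q is meant to be exact: the notion is used only when q divides p - 1.
  The witness is an integer, so that w ^ ((p - 1) div q) - 1 is not truncated.
\<close>

definition valid_pocklington_witness :: "nat \<Rightarrow> nat \<Rightarrow> int \<Rightarrow> bool" where
  "valid_pocklington_witness p q w \<longleftrightarrow>
     [w ^ (p - 1) = 1] (mod int p) \<and> gcd (w ^ ((p - 1) div q) - 1) (int p) = 1"

end

theory Submission
  imports Defs
    "HOL-Number_Theory.Number_Theory"
    "HOL-Algebra.Algebraic_Closure_Type"
    "Berlekamp_Zassenhaus.Finite_Field"
begin

text \<open>
  By Fermat's little theorem, 7 is a valid witness exactly when $7^{(p-1)/3} \not\equiv 1$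
  modulo $p$, that is, when 7 is not a cube modulo $p$. The heart of the proof is Jacobi's
  criterion (\<open>seven_cubic_residue_iff\<close>): if $4 p = L^2 + 27 M^2$, then 7 is a cube modulo $p$ if
  and only if 7 divides $L M$. For $p = 3 m (m + 1) + 1$ with $m + 1 = 3 N$ one has
  $4 p = (3 m + 1)^2 + 27 N^2$, and $N = 2^a 3^{b-1}$ is prime to 7. So 7 is a cube if and only if
  $7 \mid 3 m + 1$, which means $m \equiv 2$ modulo 7, or $2^a 3^b \equiv 3$; as 2 and 3 have
  orders 3 and 6 modulo 7, this is a condition on $a$ modulo 3 and $b$ modulo 6.

  Jacobi's criterion is proved with Gauss sums. Let $\chi$ be a cubic character modulo $p$ with
  values in a field, $G$ and $G'$ the Gauss sums of $\chi$ and $\overline{\chi}$ and $J$ the Jacobi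
  sum of $\chi$. Then $G^2 = J G'$ and $G G' = p$. These relations are used in two fields.

  Over the complex numbers they give $J \overline{J} = p$. With $J = n_0 + n_1 \omega + n_2 \omega^2$
  this says $4 p = L^2 + 3 (n_1 - n_2)^2$ with $L = 2 n_0 - n_1 - n_2$
  (\<open>four_p_eq_norm_form\<close>). A free action of order 3 shows that 3 divides $n_1$ and $n_2$
  (\<open>three_dvd_jacobi_coeff\<close>), and then $4 p = L^2 + 27 M^2$ with $3 M = n_1 - n_2$. Such a
  representation is unique up to signs (\<open>norm_form_27_unique\<close>), so $L$ and $M$ can be read off from
  any other one, up to signs.

  In an algebraic closure of the field with 7 elements the Frobenius map gives
  $G^7 = \overline{\chi}(7) G$, while $G^3 = J p$; hence $\overline{\chi}(7) = (J p)^2$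
  (\<open>chi_7_eq_jacobi\<close>). There $\omega$ may be taken to be 2, and $J$ is the residue of
  $n_0 + 2 n_1 + 4 n_2$ with the same integers $n_i$. In terms of $L$ and $M$, the condition
  $(J p)^2 = 1$ in characteristic 7 is $7 \mid L M$ (\<open>sixth_power_form_mod_7\<close>).
\<close>

(* The primes of this theory are those of the numbers, not the prime elements of a monoid. *)
hide_const (open) Divisibility.prime

section \<open>The norm form $L^2 + 27 M^2$\<close>

text \<open>
  For two representations $(L, M)$ and $(L', M')$ the product $(L M' - L' M)(L M' + L' M)$ equals
  $4 p (M'^2 - M^2)$, so after changing the sign of $L'$ the first factor is a multiple of $p$.
  Composition of the two forms gives $16 p^2 = (L L' + 27 M M')^2 + 27 (L M' - L' M)^2$, and since $27 > 16$ the
  factor divisible by $p$ has to vanish: the representations are proportional.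
\<close>

lemma norm_form_27_unique:
  fixes p :: nat and L M L' M' :: int
  assumes p: "prime p"
    and 1: "4 * int p = L\<^sup>2 + 27 * M\<^sup>2"
    and 2: "4 * int p = L'\<^sup>2 + 27 * M'\<^sup>2"
  shows "L'\<^sup>2 = L\<^sup>2 \<and> M'\<^sup>2 = M\<^sup>2"
proof -
  have p0: "int p > 0" using p by (simp add: prime_gt_0_nat)
  have main: "L'\<^sup>2 = L\<^sup>2 \<and> M'\<^sup>2 = M\<^sup>2"
    if d: "int p dvd L * M' - L' * M" and 2: "4 * int p = L'\<^sup>2 + 27 * M'\<^sup>2" for L' M' :: int
  proof -
    obtain k where k: "L * M' - L' * M = int p * k" using d by (auto elim: dvdE)
    have "16 * (int p)\<^sup>2 = (4 * int p) * (4 * int p)" by (simp add: power2_eq_square)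
    also have "\<dots> = (L\<^sup>2 + 27 * M\<^sup>2) * (L'\<^sup>2 + 27 * M'\<^sup>2)" using 1 2 by simp
    also have "\<dots> = (L * L' + 27 * M * M')\<^sup>2 + 27 * (L * M' - L' * M)\<^sup>2"
      by (simp add: power2_eq_square algebra_simps)
    finally have "27 * (int p * k)\<^sup>2 \<le> 16 * (int p)\<^sup>2" unfolding k by simp
    hence "(27 * k\<^sup>2) * (int p)\<^sup>2 \<le> 16 * (int p)\<^sup>2" by (simp add: power_mult_distrib mult_ac)
    hence "27 * k\<^sup>2 \<le> 16" using p0 by (simp add: mult_le_cancel_right)
    moreover have "k\<^sup>2 \<ge> 1" if "k \<noteq> 0" using that
      by (metis int_one_le_iff_zero_less zero_less_power2)
    ultimately have "k = 0" by (cases "k = 0") auto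
    hence eq: "L * M' = L' * M" using k by simp
    have "(4 * int p) * M'\<^sup>2 = (4 * int p) * M\<^sup>2"
    proof -
      have "(4 * int p) * M'\<^sup>2 = (L * M')\<^sup>2 + 27 * M\<^sup>2 * M'\<^sup>2"
        unfolding 1 by (simp add: algebra_simps power_mult_distrib)
      also have "\<dots> = (4 * int p) * M\<^sup>2"
        unfolding eq 2 by (simp add: algebra_simps power_mult_distrib)
      finally show ?thesis .
    qed
    hence "M'\<^sup>2 = M\<^sup>2" using p0 by simp
    thus ?thesis using 1 2 by simp
  qed
  have "(L * M' - L' * M) * (L * M' - (- L') * M) = (L\<^sup>2 + 27 * M\<^sup>2) * M'\<^sup>2 - (L'\<^sup>2 + 27 * M'\<^sup>2) * M\<^sup>2"
    by (simp add: power2_eq_square algebra_simps)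
  also have "\<dots> = int p * (4 * (M'\<^sup>2 - M\<^sup>2))"
    unfolding 1[symmetric] 2[symmetric] by (simp add: algebra_simps)
  finally have "int p dvd (L * M' - L' * M) * (L * M' - (- L') * M)" by simp
  hence "int p dvd L * M' - L' * M \<or> int p dvd L * M' - (- L') * M"
    using p by (simp add: prime_dvd_mult_iff)
  thus ?thesis
  proof
    assume "int p dvd L * M' - L' * M"
    thus ?thesis using 2 by (rule main)
  next
    assume "int p dvd L * M' - (- L') * M"
    from main[OF this] show ?thesis using 2 by simp
  qed
qed

text \<open>
  The orbits $\{x, f(x), f(f(x))\}$ have three elements each and partition $A$.
\<close>

lemma three_dvd_card_if_free_action_of_order_3:
  assumes "finite A" and "\<And>x. x \<in> A \<Longrightarrow> f x \<in> A" and "\<And>x. x \<in> A \<Longrightarrow> f (f (f x)) = x"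
    and "\<And>x. x \<in> A \<Longrightarrow> f x \<noteq> x"
  shows "3 dvd card A"
  using assms
proof (induction "card A" arbitrary: A rule: less_induct)
  case less
  show ?case
  proof (cases "A = {}")
    case False
    then obtain x where x: "x \<in> A" by auto
    define B where "B = {x, f x, f (f x)}"
    have BA: "B \<subseteq> A" using less.prems(2) x by (auto simp: B_def)
    have "f (f x) \<noteq> x" using less.prems(3,4) x by metis
    hence cB: "card B = 3" using less.prems(2,4) x unfolding B_def by (smt (verit) card_3_iff)
    have inj: "f y \<notin> B" if y: "y \<in> A" "y \<notin> B" for y
      using less.prems(3)[OF y(1)] less.prems(3)[OF x] y by (auto simp: B_def)
    have fB: "finite B" by (simp add: B_def)
    have card: "card (A - B) = card A - 3" using card_Diff_subset[OF fB BA] cB by simp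
    have le: "3 \<le> card A" using card_mono[OF less.prems(1) BA] cB by simp
    have "3 dvd card (A - B)"
      by (rule less.hyps) (use less.prems inj card le in auto)
    thus ?thesis using card le by (metis dvd_add_triv_right_iff le_add_diff_inverse2)
  qed simp
qed

section \<open>The cubic class of a residue\<close>

locale cubic_class =
  fixes p c :: nat
  assumes prime_p: "prime p" and three_dvd: "3 dvd p - 1" and primroot: "residue_primroot p c"
begin

text \<open>
  The discrete logarithm to the base $c$ is determined modulo $p - 1$, hence modulo 3. Storing
  the exponent instead of a root of unity lets the same class define a cubic character with
  values in any field that has a primitive cube root of unity.
\<close>

definition cls :: "nat \<Rightarrow> nat" where
  "cls x = (SOME k. [c ^ k = x] (mod p)) mod 3"

lemma p_gt_1: "p > 1" using prime_p by (rule prime_gt_1_nat)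

lemma p_gt_3: "p > 3"
proof -
  have "p - 1 \<ge> 3" using three_dvd p_gt_1 by (intro dvd_imp_le) auto
  thus ?thesis by simp
qed

lemma coprime_c: "coprime p c" and ord_c: "ord p c = p - 1"
  using primroot prime_p by (auto simp: residue_primroot_def totient_prime)

lemma not_dvd_c: "\<not> p dvd c"
  using coprime_c p_gt_1 by (metis coprime_common_divisor_nat dvd_refl less_irrefl)

lemma coprime_iff: "coprime p x \<longleftrightarrow> \<not> p dvd x"
  using prime_p by (metis coprime_absorb_left not_prime_unit prime_imp_coprime)

lemma dlog_exists:
  assumes "\<not> p dvd x" shows "\<exists>k. [c ^ k = x] (mod p)"
proof -
  have "x mod p \<in> totatives p"
    using assms p_gt_1 prime_p by (auto simp: totatives_prime dvd_eq_mod_eq_0)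
  then obtain i where "x mod p = c ^ i mod p"
    using residue_primroot_is_generator[OF p_gt_1 primroot] by (auto simp: bij_betw_def)
  thus ?thesis by (auto simp: cong_def intro!: exI[of _ i])
qed

lemma cls_eq:
  assumes "[c ^ k = x] (mod p)" shows "cls x = k mod 3"
proof -
  have "[c ^ (SOME k. [c ^ k = x] (mod p)) = x] (mod p)" using assms by (rule someI)
  hence "[c ^ (SOME k. [c ^ k = x] (mod p)) = c ^ k] (mod p)"
    using assms by (metis cong_sym cong_trans)
  hence "[(SOME k. [c ^ k = x] (mod p)) = k] (mod (p - 1))"
    using order_divides_expdiff[OF coprime_c] ord_c by simp
  hence "[(SOME k. [c ^ k = x] (mod p)) = k] (mod 3)"
    using three_dvd by (metis cong_dvd_modulus_nat)
  thus ?thesis by (simp add: cls_def cong_def)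
qed

lemma cls_less_3: "cls x < 3" by (simp add: cls_def)

lemma cls_cong: "[x = y] (mod p) \<Longrightarrow> cls x = cls y"
  by (simp add: cls_def cong_def)

lemma cls_mult:
  assumes "\<not> p dvd x" "\<not> p dvd y"
  shows "cls (x * y) = (cls x + cls y) mod 3"
proof -
  obtain i j where "[c ^ i = x] (mod p)" "[c ^ j = y] (mod p)"
    using dlog_exists assms by blast
  moreover from this have "[c ^ (i + j) = x * y] (mod p)"
    by (simp add: power_add cong_mult)
  ultimately show ?thesis by (simp add: cls_eq mod_add_eq)
qed

lemma cls_power:
  assumes "\<not> p dvd x" shows "cls (x ^ n) = n * cls x mod 3"
proof -
  obtain i where i: "[c ^ i = x] (mod p)" using dlog_exists assms by blast
  hence "[c ^ (i * n) = x ^ n] (mod p)" by (simp add: power_mult cong_pow)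
  thus ?thesis using i by (simp add: cls_eq mod_mult_right_eq mult.commute)
qed

lemma cls_primroot: "cls c = 1"
  using cls_eq[of 1 c] by simp

lemma cls_1: "cls 1 = 0"
  using cls_eq[of 0 1] by simp

lemma cls_minus_1: "cls (p - 1) = 0"
proof -
  have nd: "\<not> p dvd p - 1" using p_gt_1 by (auto dest: dvd_imp_le)
  have "[(p - 1) ^ 2 = 1] (mod p)"
  proof -
    have "p = (p - 2) + 2" using p_gt_3 by simp
    then obtain q where "p = q + 2" by blast
    hence "(p - 1) ^ 2 = 1 + p * (p - 2)" by (simp add: power2_eq_square)
    thus ?thesis by (simp add: cong_def del: One_nat_def)
  qed
  hence "2 * cls (p - 1) mod 3 = 0" using cls_power[OF nd, of 2] cls_1 by (auto dest: cls_cong)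
  thus ?thesis using cls_less_3[of "p - 1"] by presburger
qed

lemma euler_cubic_criterion:
  assumes "\<not> p dvd x"
  shows "[x ^ ((p - 1) div 3) = 1] (mod p) \<longleftrightarrow> cls x = 0"
proof -
  obtain k where k: "[c ^ k = x] (mod p)" using dlog_exists assms by blast
  define n where "n = (p - 1) div 3"
  have n: "p - 1 = 3 * n" "n > 0" using three_dvd p_gt_3 by (auto simp: n_def)
  have "[x ^ n = c ^ (k * n)] (mod p)"
    using k by (metis cong_pow cong_sym power_mult)
  hence "[x ^ n = 1] (mod p) \<longleftrightarrow> [c ^ (k * n) = 1] (mod p)"
    by (auto simp: cong_def)
  also have "\<dots> \<longleftrightarrow> 3 * n dvd k * n" by (simp add: ord_divides ord_c n del: One_nat_def)
  also have "\<dots> \<longleftrightarrow> cls x = 0" using n by (simp add: cls_eq[OF k] dvd_eq_mod_eq_0)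
  finally show ?thesis by (simp add: n_def)
qed

lemma bij_mult:
  assumes "\<not> p dvd s"
  shows "bij_betw (\<lambda>x. x * s mod p) {1..<p} {1..<p}"
proof -
  have inj: "inj_on (\<lambda>x. x * s mod p) {1..<p}"
  proof (rule inj_onI)
    fix x y assume xy: "x \<in> {1..<p}" "y \<in> {1..<p}" "x * s mod p = y * s mod p"
    hence "[x = y] (mod p)" using assms coprime_iff
      by (metis cong_def cong_mult_rcancel_nat coprime_commute)
    thus "x = y" using xy by (simp add: cong_def)
  qed
  moreover have "(\<lambda>x. x * s mod p) ` {1..<p} \<subseteq> {1..<p}"
  proof safe
    fix x assume "x \<in> {1..<p}"
    hence "\<not> p dvd x * s" using assms prime_p by (auto simp: prime_dvd_mult_iff dest: dvd_imp_le)
    thus "x * s mod p \<in> {1..<p}" using p_gt_1 by (auto simp: dvd_eq_mod_eq_0)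
  qed
  ultimately show ?thesis by (simp add: bij_betw_def endo_inj_surj)
qed

lemma unit_not_dvd: "x \<in> {1..<p} \<Longrightarrow> \<not> p dvd x" by (auto dest: dvd_imp_le)

text \<open>
  The coefficients of the Jacobi sum with respect to the powers $1, \omega, \omega^2$. They do
  not depend on the field in which $\omega$ lives, which is what links the complex Jacobi sum to
  the one in characteristic 7. The range leaves out $t = p - 1$, where $t (t + 1)$ is not a unit.
\<close>

definition jacobi_coeff :: "nat \<Rightarrow> nat" where
  "jacobi_coeff i = card {t \<in> {1..<p-1}. cls (t * (t + 1)) = i}"

text \<open>
  The map $t \mapsto -1/(t+1)$ has order 3. Writing $s$ for the image of $t$, one has
  $s (s + 1) (t + 1)^3 \equiv -t (t + 1)$, and $-1$ is a cube, so the class of $t (t + 1)$ is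
  preserved. A fixed point satisfies $t (t + 1) \equiv -1$, a cube; hence the action on the
  residues of a nonzero class is free.
\<close>

lemma three_dvd_jacobi_coeff:
  assumes "i \<noteq> 0" shows "3 dvd jacobi_coeff i"
proof -
  \<comment> \<open>\<open>P t s\<close> says that \<open>s\<close> represents $-1/(t+1)$ modulo \<open>p\<close>, without using inverses.\<close>
  define P where "P = (\<lambda>t s. s \<in> {1..<p} \<and> p dvd s * (t + 1) + 1)"
  define f where "f = (\<lambda>t. THE s. P t s)"
  have P_unique: "s = s'" if "P t s" "P t s'" for t s s'
  proof -
    have nd: "\<not> p dvd t + 1"
    proof
      assume "p dvd t + 1"
      hence "p dvd s * (t + 1)" by (rule dvd_mult)
      hence "p dvd 1" using that(1) unfolding P_def by (metis dvd_add_right_iff)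
      thus False using p_gt_1 by simp
    qed
    have "[s * (t + 1) + 1 = s' * (t + 1) + 1] (mod p)"
      using that by (simp add: P_def cong_def dvd_eq_mod_eq_0)
    hence "[s * (t + 1) = s' * (t + 1)] (mod p)" by (simp only: cong_add_rcancel_nat)
    hence "[s = s'] (mod p)" using nd coprime_iff coprime_commute
      by (metis cong_mult_rcancel_nat)
    thus ?thesis using that by (simp add: P_def cong_def)
  qed
  have P_f: "P t (f t)" if t: "t \<in> {1..<p-1}" for t
  proof -
    have "\<not> p dvd t + 1" using t by (intro unit_not_dvd) auto
    from bij_mult[OF this] have "p - 1 \<in> (\<lambda>x. x * (t + 1) mod p) ` {1..<p}"
      using p_gt_1 by (simp add: bij_betw_def)
    then obtain s where s: "s \<in> {1..<p}" "s * (t + 1) mod p = p - 1" by auto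
    have "(s * (t + 1) + 1) mod p = (s * (t + 1) mod p + 1) mod p" by (simp add: mod_simps)
    hence "P t s" using s p_gt_1 by (simp add: P_def dvd_eq_mod_eq_0)
    thus ?thesis unfolding f_def using P_unique by (metis theI)
  qed
  have f_eq: "f t = s" if "t \<in> {1..<p-1}" "P t s" for t s
    using P_unique[OF P_f[OF that(1)] that(2)] .
  have f_less: "f t < p - 1" if t: "t \<in> {1..<p-1}" for t
  proof (rule ccontr)
    assume "\<not> f t < p - 1"
    hence eq: "f t = p - 1" using P_f[OF t] by (auto simp: P_def)
    have "f t * (t + 1) + 1 + t = p * (t + 1)"
    proof -
      have "p = (p - 1) + 1" using p_gt_1 by simp
      then obtain q where "p = q + 1" by blast
      thus ?thesis unfolding eq by simp
    qed
    hence "p dvd f t * (t + 1) + 1 + t" by simp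
    hence "p dvd t" using P_f[OF t] by (metis P_def dvd_add_right_iff)
    thus False using t by (auto dest: dvd_imp_le)
  qed
  have f_mem: "f t \<in> {1..<p-1}" if "t \<in> {1..<p-1}" for t
    using f_less[OF that] P_f[OF that] by (auto simp: P_def)
  have f_cls: "cls (f t * (f t + 1)) = cls (t * (t + 1))" if t: "t \<in> {1..<p-1}" for t
  proof -
    define s where "s = f t"
    have s: "s \<in> {1..<p-1}" "p dvd s * (t + 1) + 1" using P_f[OF t] f_mem[OF t] by (auto simp: s_def P_def)
    have nd: "\<not> p dvd t" "\<not> p dvd t + 1" "\<not> p dvd s" "\<not> p dvd s + 1" "\<not> p dvd p - 1"
      using t s p_gt_1 by (intro unit_not_dvd; auto)+
    have nd': "\<not> p dvd s * (s + 1)" "\<not> p dvd (t + 1) ^ 3" "\<not> p dvd t * (t + 1)"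
      using nd prime_p by (auto simp: prime_dvd_mult_iff simp del: mult_Suc_right dest!: prime_dvd_power)
    have "int p dvd int (s * (t + 1) + 1)" using s(2) by presburger
    hence "int p dvd int s * (int t + 1) + 1" by (simp only: of_nat_add of_nat_mult of_nat_1)
    then obtain k where k: "int s * (int t + 1) + 1 = int p * k" by (auto elim: dvdE)
    have "int s * (int s + 1) * (int t + 1) ^ 3 - (int p - 1) * (int t * (int t + 1))
       = (int s * (int t + 1) + 1) * (int t + 1) * (int s * (int t + 1) + int t) - int p * (int t * (int t + 1))"
      by Groebner_Basis.algebra
    hence "int p dvd int s * (int s + 1) * (int t + 1) ^ 3 - (int p - 1) * (int t * (int t + 1))"
      unfolding k by simp
    hence "int p dvd int (s * (s + 1) * (t + 1) ^ 3) - int ((p - 1) * (t * (t + 1)))"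
      using p_gt_1 by (simp only: of_nat_diff less_imp_le of_nat_mult of_nat_add of_nat_power of_nat_1)
    hence "[s * (s + 1) * (t + 1) ^ 3 = (p - 1) * (t * (t + 1))] (mod p)"
      by (simp only: cong_iff_dvd_diff flip: cong_int_iff)
    hence "cls (s * (s + 1) * (t + 1) ^ 3) = cls ((p - 1) * (t * (t + 1)))" by (rule cls_cong)
    hence "cls (s * (s + 1)) mod 3 = cls (t * (t + 1)) mod 3"
      by (simp only: cls_mult[OF nd'(1,2)] cls_mult[OF nd(5) nd'(3)] cls_power[OF nd(2)] cls_minus_1) simp
    thus ?thesis unfolding s_def using cls_less_3 by (metis mod_less)
  qed
  have f_f_f: "f (f (f t)) = t" if t: "t \<in> {1..<p-1}" for t
  proof (rule f_eq)
    define s r where "s = f t" and "r = f s"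
    have s: "s \<in> {1..<p-1}" "p dvd s * (t + 1) + 1" using P_f[OF t] f_mem[OF t] by (auto simp: s_def P_def)
    have r: "r \<in> {1..<p-1}" "p dvd r * (s + 1) + 1" using P_f[OF s(1)] f_mem[OF s(1)] by (auto simp: r_def P_def)
    show "f (f t) \<in> {1..<p-1}" using r by (simp add: r_def s_def)
    have "int p dvd int (s * (t + 1) + 1)" "int p dvd int (r * (s + 1) + 1)"
      using s(2) r(2) by presburger+
    hence d: "int p dvd int s * (int t + 1) + 1" "int p dvd int r * (int s + 1) + 1"
      by (simp_all only: of_nat_add of_nat_mult of_nat_1)
    have "int t * (int r + 1) + 1 =
      (int r * (int s + 1) + 1) * (int t + 1) - int r * (int s * (int t + 1) + 1)" by Groebner_Basis.algebra
    hence "int p dvd int t * (int r + 1) + 1" using d by simp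
    hence "int p dvd int (t * (r + 1) + 1)" by (simp only: of_nat_add of_nat_mult of_nat_1)
    hence "p dvd t * (r + 1) + 1" by presburger
    thus "P (f (f t)) t" using t by (auto simp: P_def r_def s_def)
  qed
  have f_neq: "f t \<noteq> t" if t: "t \<in> {1..<p-1}" and "cls (t * (t + 1)) \<noteq> 0" for t
  proof
    assume "f t = t"
    hence "p dvd t * (t + 1) + 1" using P_f[OF t] by (simp add: P_def)
    moreover have "p dvd (p - 1) + 1" using p_gt_1 by simp
    ultimately have "[t * (t + 1) + 1 = (p - 1) + 1] (mod p)" by (simp add: cong_def dvd_eq_mod_eq_0)
    hence "[t * (t + 1) = p - 1] (mod p)" by (simp only: cong_add_rcancel_nat)
    hence "cls (t * (t + 1)) = 0" using cls_minus_1 by (simp add: cls_cong)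
    thus False using that by simp
  qed
  show ?thesis unfolding jacobi_coeff_def
    by (rule three_dvd_card_if_free_action_of_order_3[where f = f])
       (use f_mem f_cls f_f_f f_neq assms in auto)
qed

end

section \<open>Cubic Gauss and Jacobi sums over a field\<close>

lemma cube_root_of_unity_power_mod_3:
  fixes w :: "'a :: field"
  assumes "w ^ 3 = 1" shows "w ^ (n mod 3) = w ^ n"
proof -
  have "w ^ n = w ^ (3 * (n div 3) + n mod 3)" by simp
  also have "\<dots> = w ^ (n mod 3)" unfolding power_add power_mult assms by simp
  finally show ?thesis by simp
qed

text \<open>
  A root of $1 + x + \dots + x^{n-1}$ is an $n$-th root of unity, and 1 is not such a root
  because the value at 1 is $n \neq 0$.
\<close>

lemma nontrivial_root_of_unity_exists:
  assumes "n > 1" and "of_nat n \<noteq> (0 :: 'a :: alg_closed_field)"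
  shows "\<exists>z :: 'a. z ^ n = 1 \<and> z \<noteq> 1"
proof -
  obtain m where n: "n = Suc m" "m > 0" using assms(1) by (cases n) auto
  obtain z :: 'a where z: "(\<Sum>k\<le>m. 1 * z ^ k) = 0"
    using alg_closed[of m "\<lambda>_. 1"] n by auto
  have "z \<noteq> 1" using z assms(2) n by auto
  moreover have "z ^ n = 1"
    using z \<open>z \<noteq> 1\<close> sum_gp_strict[of z n] n by (simp add: lessThan_Suc_atMost)
  ultimately show ?thesis by blast
qed

context cubic_class
begin

definition chi :: "'a :: field \<Rightarrow> nat \<Rightarrow> 'a" where
  "chi w x = (if p dvd x then 0 else w ^ cls x)"

definition gauss_sum :: "'a :: field \<Rightarrow> 'a \<Rightarrow> nat \<Rightarrow> 'a" where
  "gauss_sum w z s = (\<Sum>x\<in>{1..<p}. chi w x * z ^ (x * s))"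

text \<open>
  The usual Jacobi sum is over $\chi(x) \chi(1-x)$. Since $\chi(-1) = 1$, the substitution
  $x = -t$ gives the form used here, which stays within the natural numbers.
\<close>

definition jacobi_sum :: "'a :: field \<Rightarrow> 'a" where
  "jacobi_sum w = (\<Sum>t\<in>{1..<p}. chi w t * chi w (t + 1))"

lemma chi_mult: "w ^ 3 = 1 \<Longrightarrow> chi w (x * y) = chi w x * chi w y"
  using prime_p
  by (auto simp: chi_def prime_dvd_mult_iff cls_mult cube_root_of_unity_power_mod_3 power_add)

lemma chi_cong: "[x = y] (mod p) \<Longrightarrow> chi w x = chi w y"
  by (simp add: chi_def cls_cong cong_dvd_iff)

lemma chi_mod: "chi w (x mod p) = chi w x"
  by (rule chi_cong) simp

lemma chi_square: "chi (w\<^sup>2) x = (chi w x)\<^sup>2"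
  by (simp add: chi_def mult.commute flip: power_mult)

lemma chi_times_chi: "chi w x * chi w x = chi (w\<^sup>2) x"
  unfolding chi_square by (rule power2_eq_square[symmetric])

lemma chi_cube: "w ^ 3 = 1 \<Longrightarrow> \<not> p dvd x \<Longrightarrow> chi w x ^ 3 = 1"
  unfolding chi_def by (simp add: mult.commute[of _ 3] power_mult flip: power_mult[of _ _ 3])

lemma chi_dvd: "p dvd x \<Longrightarrow> chi w x = 0"
  by (simp add: chi_def)

lemma chi_minus_1: "chi w (p - 1) = 1"
  using unit_not_dvd[of "p - 1"] p_gt_1 by (simp add: chi_def cls_minus_1 del: One_nat_def)

lemma chi_primroot: "chi w c = w"
  using not_dvd_c by (simp add: chi_def cls_primroot)

lemma sum_units_mult:
  assumes "\<not> p dvd s"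
  shows "(\<Sum>x\<in>{1..<p}. f (x * s mod p)) = (\<Sum>x\<in>{1..<p}. f x)"
  by (rule sum.reindex_bij_betw[OF bij_mult[OF assms]])

text \<open>
  Multiplication by the primitive root permutes the units and multiplies the sum by $\omega \neq 1$.
\<close>

lemma sum_chi:
  fixes w :: "'a :: field"
  assumes "w ^ 3 = 1" "w \<noteq> 1"
  shows "(\<Sum>x\<in>{1..<p}. chi w x) = 0"
proof -
  have "(\<Sum>x\<in>{1..<p}. chi w x) = (\<Sum>x\<in>{1..<p}. chi w (x * c mod p))"
    by (rule sum_units_mult[OF not_dvd_c, symmetric])
  also have "\<dots> = w * (\<Sum>x\<in>{1..<p}. chi w x)"
    using not_dvd_c by (simp add: chi_mod chi_mult[OF assms(1)] sum_distrib_left mult_ac chi_primroot)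
  finally have "(1 - w) * (\<Sum>x\<in>{1..<p}. chi w x) = 0" by (simp add: algebra_simps)
  thus ?thesis using assms(2) by simp
qed

lemma power_mod_p: "z ^ p = 1 \<Longrightarrow> z ^ (n mod p) = (z :: 'a :: field) ^ n"
  by (metis mult_div_mod_eq power_add power_mult power_one mult_1)

lemma sum_roots_of_unity:
  fixes z :: "'a :: field"
  assumes "z ^ p = 1" "z \<noteq> 1"
  shows "(\<Sum>x\<in>{1..<p}. z ^ (x * s)) = (if p dvd s then of_nat p else 0) - 1"
proof (cases "p dvd s")
  case True
  hence "z ^ (x * s) = 1" for x using assms(1) by (auto simp: power_mult elim!: dvdE)
     (metis mult.left_commute power_mult power_one)
  thus ?thesis using True p_gt_1 by (simp add: of_nat_diff)
next
  case False
  have "(\<Sum>x\<in>{1..<p}. z ^ (x * s)) = (\<Sum>x\<in>{1..<p}. z ^ (x * s mod p))"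
    by (simp add: power_mod_p[OF assms(1)])
  also have "\<dots> = (\<Sum>x\<in>{1..<p}. z ^ x)" by (rule sum_units_mult[OF False])
  also have "\<dots> = (\<Sum>x<p. z ^ x) - 1"
  proof -
    have "{..<p} = insert 0 {1..<p}" using p_gt_1 by auto
    thus ?thesis by simp
  qed
  also have "(\<Sum>x<p. z ^ x) = 0" using assms by (simp add: sum_gp_strict)
  finally show ?thesis using False by simp
qed

text \<open>
  The factor is $\overline{\chi}(s)$, written as $\chi(s)^2$; this form covers the case
  $p \mid s$ as well, where both sides vanish.
\<close>

lemma gauss_sum_twist:
  fixes w z :: "'a :: field"
  assumes w: "w ^ 3 = 1" "w \<noteq> 1" and z: "z ^ p = 1"
  shows "gauss_sum w z s = (chi w s)\<^sup>2 * gauss_sum w z 1"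
proof (cases "p dvd s")
  case True
  hence "z ^ (x * s) = 1" for x using z by (auto simp: power_mult elim!: dvdE)
     (metis mult.left_commute power_mult power_one)
  hence "gauss_sum w z s = 0" unfolding gauss_sum_def by (simp add: sum_chi[OF w] del: One_nat_def)
  thus ?thesis using True by (simp add: chi_dvd)
next
  case False
  have "gauss_sum w z 1 = (\<Sum>x\<in>{1..<p}. chi w (x * s mod p) * z ^ (x * s mod p * 1))"
    unfolding gauss_sum_def by (rule sum_units_mult[OF False, symmetric])
  also have "\<dots> = chi w s * gauss_sum w z s"
    by (simp add: chi_mod chi_mult[OF w(1)] power_mod_p[OF z] gauss_sum_def sum_distrib_left mult_ac)
  finally have "(chi w s)\<^sup>2 * gauss_sum w z 1 = chi w s ^ 3 * gauss_sum w z s"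
    by (simp add: power2_eq_square power3_eq_cube)
  thus ?thesis using chi_cube[OF w(1) False] by simp
qed

text \<open>
  Substituting $y = t x$ in the double sum over $x, y$ separates the two characters.
\<close>

lemma gauss_sum_product:
  fixes w v z :: "'a :: field"
  assumes "v ^ 3 = 1" and z: "z ^ p = 1"
  shows "gauss_sum w z 1 * gauss_sum v z 1
    = (\<Sum>t\<in>{1..<p}. chi v t * (\<Sum>x\<in>{1..<p}. chi w x * chi v x * z ^ (x * (t + 1))))"
proof -
  have "gauss_sum w z 1 * gauss_sum v z 1 = (\<Sum>x\<in>{1..<p}. chi w x * z ^ x * gauss_sum v z 1)"
    by (simp add: gauss_sum_def sum_distrib_right)
  also have "\<dots> = (\<Sum>x\<in>{1..<p}. \<Sum>t\<in>{1..<p}. chi w x * z ^ x * (chi v (t * x) * z ^ (t * x)))"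
  proof (rule sum.cong[OF refl])
    fix x assume x: "x \<in> {1..<p}"
    have "gauss_sum v z 1 = (\<Sum>t\<in>{1..<p}. chi v (t * x mod p) * z ^ (t * x mod p * 1))"
      unfolding gauss_sum_def by (rule sum_units_mult[OF unit_not_dvd[OF x], symmetric])
    thus "chi w x * z ^ x * gauss_sum v z 1
        = (\<Sum>t\<in>{1..<p}. chi w x * z ^ x * (chi v (t * x) * z ^ (t * x)))"
      by (simp add: chi_mod power_mod_p[OF z] sum_distrib_left)
  qed
  also have "\<dots> = (\<Sum>t\<in>{1..<p}. \<Sum>x\<in>{1..<p}. chi w x * z ^ x * (chi v (t * x) * z ^ (t * x)))"
    by (rule sum.swap)
  also have "\<dots> = (\<Sum>t\<in>{1..<p}. chi v t * (\<Sum>x\<in>{1..<p}. chi w x * chi v x * z ^ (x * (t + 1))))"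
    by (simp add: chi_mult[OF assms(1)] sum_distrib_left power_add mult_ac)
  finally show ?thesis .
qed

end

text \<open>
  Here \<open>w\<close> is the cube root of unity $\omega$ that gives the values of the cubic character $\chi$,
  so \<open>w\<^sup>2\<close> gives $\overline{\chi}$, and \<open>z\<close> is the base of the additive character. The setting covers
  the complex numbers as well as characteristic 7.
\<close>

locale cubic_gauss = cubic_class p c for p c :: nat +
  fixes w z :: "'a :: field"
  assumes w_cube: "w ^ 3 = 1" and w_neq_1: "w \<noteq> 1"
    and z_power: "z ^ p = 1" and z_neq_1: "z \<noteq> 1"
    and p_neq_0: "of_nat p \<noteq> (0 :: 'a)"
begin

abbreviation "G \<equiv> gauss_sum w z 1"
abbreviation "G' \<equiv> gauss_sum (w\<^sup>2) z 1"

lemma w2: "(w\<^sup>2) ^ 3 = 1" "w\<^sup>2 \<noteq> 1"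
proof -
  have "(w\<^sup>2) ^ 3 = (w ^ 3)\<^sup>2" by (simp flip: power_mult)
  thus "(w\<^sup>2) ^ 3 = 1" by (simp add: w_cube)
  show "w\<^sup>2 \<noteq> 1" using w_cube w_neq_1 by (auto simp: power3_eq_cube power2_eq_square)
qed

lemma w2_square: "(w\<^sup>2)\<^sup>2 = w"
  using w_cube w_neq_1 by (simp add: power2_eq_square power3_eq_cube mult_ac)

text \<open>
  In the expansion of \<open>gauss_sum_product\<close> the inner sums are Gauss sums of $\chi^2$, twisted by
  $t + 1$; untwisting them leaves the factor $\chi(t + 1)$.
\<close>

lemma gauss_square: "G\<^sup>2 = jacobi_sum w * G'"
proof -
  have "G\<^sup>2 = (\<Sum>t\<in>{1..<p}. chi w t * (\<Sum>x\<in>{1..<p}. chi w x * chi w x * z ^ (x * (t + 1))))"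
    unfolding power2_eq_square by (rule gauss_sum_product[OF w_cube z_power])
  also have "\<dots> = (\<Sum>t\<in>{1..<p}. chi w t * gauss_sum (w\<^sup>2) z (t + 1))"
    by (simp only: gauss_sum_def chi_times_chi)
  also have "\<dots> = (\<Sum>t\<in>{1..<p}. chi w t * (chi ((w\<^sup>2)\<^sup>2) (t + 1) * G'))"
    unfolding gauss_sum_twist[OF w2 z_power, of "_ + 1"] chi_square[symmetric] ..
  also have "\<dots> = jacobi_sum w * G'"
    unfolding w2_square jacobi_sum_def sum_distrib_right by (simp only: mult.assoc)
  finally show ?thesis .
qed

text \<open>
  The character values cancel in the inner sums, which are $p - 1$ for $t = p - 1$ and $-1$
  otherwise. The contribution of $-1$ vanishes because $\overline{\chi}$ sums to 0.
\<close>

lemma gauss_conj: "G * G' = of_nat p"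
proof -
  have "G * G' = (\<Sum>t\<in>{1..<p}. chi (w\<^sup>2) t * (\<Sum>x\<in>{1..<p}. chi w x * chi (w\<^sup>2) x * z ^ (x * (t + 1))))"
    by (rule gauss_sum_product[OF w2(1) z_power])
  also have "\<dots> = (\<Sum>t\<in>{1..<p}. chi (w\<^sup>2) t * (\<Sum>x\<in>{1..<p}. z ^ (x * (t + 1))))"
  proof -
    have "chi w x * chi (w\<^sup>2) x = 1" if "x \<in> {1..<p}" for x
      using chi_cube[OF w_cube unit_not_dvd[OF that]]
      by (simp add: power3_eq_cube mult.assoc flip: chi_times_chi)
    thus ?thesis by simp
  qed
  also have "\<dots> = (\<Sum>t\<in>{1..<p}. chi (w\<^sup>2) t * (if p dvd t + 1 then of_nat p else 0)) - (\<Sum>t\<in>{1..<p}. chi (w\<^sup>2) t)"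
    unfolding sum_roots_of_unity[OF z_power z_neq_1] by (simp add: algebra_simps sum_subtractf)
  also have "(\<Sum>t\<in>{1..<p}. chi (w\<^sup>2) t) = 0" by (rule sum_chi[OF w2])
  also have "(\<Sum>t\<in>{1..<p}. chi (w\<^sup>2) t * (if p dvd t + 1 then of_nat p else 0))
      = (\<Sum>t\<in>{1..<p}. if t = p - 1 then of_nat p else 0)"
  proof (rule sum.cong[OF refl])
    fix t assume t: "t \<in> {1..<p}"
    have "p dvd t + 1 \<longleftrightarrow> t = p - 1"
    proof
      assume "p dvd t + 1"
      hence "p \<le> t + 1" by (intro dvd_imp_le) auto
      hence "p = t + 1" using t by simp
      thus "t = p - 1" by simp
    qed (use p_gt_1 in simp)
    thus "chi (w\<^sup>2) t * (if p dvd t + 1 then of_nat p else 0) = (if t = p - 1 then of_nat p else 0)"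
      by (simp add: chi_minus_1 del: One_nat_def)
  qed
  also have "\<dots> = of_nat p" using p_gt_1 by (simp add: sum.delta)
  finally show ?thesis by simp
qed

lemma gauss_nonzero: "G \<noteq> 0" "G' \<noteq> 0"
  using gauss_conj p_neq_0 by auto

lemma conjugate: "cubic_gauss p c (w\<^sup>2) z"
  by unfold_locales (use w2 z_power z_neq_1 p_neq_0 in auto)

text \<open>
  Multiplying $G^2 = J G'$ with the corresponding relation $G'^2 = J' G$ for $\overline{\chi}$ and
  cancelling $G G' = p$ leaves $J J' = p$.
\<close>

lemma jacobi_norm: "jacobi_sum w * jacobi_sum (w\<^sup>2) = of_nat p"
proof -
  have "G'\<^sup>2 = jacobi_sum (w\<^sup>2) * G"
    using cubic_gauss.gauss_square[OF conjugate] unfolding w2_square .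
  hence "(G * G') * (G * G') = (jacobi_sum w * jacobi_sum (w\<^sup>2)) * (G * G')"
    using gauss_square by (simp add: power2_eq_square mult_ac)
  thus ?thesis using gauss_nonzero gauss_conj p_neq_0 by simp
qed

lemma gauss_cube: "G ^ 3 = jacobi_sum w * of_nat p"
  using gauss_square gauss_conj by (simp add: power3_eq_cube power2_eq_square mult_ac)

text \<open>
  In characteristic $q$, raising the Gauss sum to the $q$-th power acts on each summand. As
  $q \equiv 1$ modulo 3, the character values are fixed and only the roots of unity move, so
  the result is a twist of the same sum.
\<close>

lemma gauss_frobenius:
  assumes q: "prime q" "CHAR('a) = q" "q mod 3 = 1"
  shows "G ^ q = (chi w q)\<^sup>2 * G"
proof -
  have "G ^ q = (\<Sum>x\<in>{1..<p}. (chi w x * z ^ (x * 1)) ^ q)"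
    unfolding gauss_sum_def by (rule freshmans_dream_sum) (use q in auto)
  also have "\<dots> = gauss_sum w z q"
    unfolding gauss_sum_def
  proof (rule sum.cong[OF refl])
    fix x assume "x \<in> {1..<p}"
    hence "chi w x ^ q = chi w x"
      using cube_root_of_unity_power_mod_3[OF chi_cube[OF w_cube unit_not_dvd], of x q] q by simp
    thus "(chi w x * z ^ (x * 1)) ^ q = chi w x * z ^ (x * q)"
      by (simp add: power_mult_distrib power_mult)
  qed
  also have "\<dots> = (chi w q)\<^sup>2 * G" by (rule gauss_sum_twist[OF w_cube w_neq_1 z_power])
  finally show ?thesis .
qed

text \<open>
  This is the reciprocity step: $G^7$ is computed once by Frobenius and once from
  $G^3 = J p$, and $G \neq 0$ may be cancelled.
\<close>

lemma chi_7_eq_jacobi: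
  assumes "CHAR('a) = 7"
  shows "(chi w 7)\<^sup>2 = (jacobi_sum w * of_nat p)\<^sup>2"
proof -
  have "G * (chi w 7)\<^sup>2 = G ^ 7" using gauss_frobenius[OF _ assms] by (simp add: mult.commute)
  also have "\<dots> = G * (G ^ 3)\<^sup>2" by (simp only: power_mult[symmetric] power_Suc[symmetric]) simp
  also have "\<dots> = G * (jacobi_sum w * of_nat p)\<^sup>2" by (simp only: gauss_cube)
  finally show ?thesis using gauss_nonzero by simp
qed

end

context cubic_class
begin

lemma jacobi_sum_eq_coeffs:
  fixes w :: "'a :: field"
  assumes w: "w ^ 3 = 1"
  shows "jacobi_sum w = of_nat (jacobi_coeff 0) + of_nat (jacobi_coeff 1) * w + of_nat (jacobi_coeff 2) * w\<^sup>2"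
proof -
  let ?A = "{1..<p-1}" and ?k = "\<lambda>t. cls (t * (t + 1))"
  have "jacobi_sum w = (\<Sum>t\<in>{1..<p}. chi w (t * (t + 1)))"
    unfolding jacobi_sum_def chi_mult[OF w] ..
  also have "\<dots> = (\<Sum>t\<in>?A. chi w (t * (t + 1)))"
  proof (intro sum.mono_neutral_right ballI)
    fix t assume "t \<in> {1..<p} - ?A"
    hence "t + 1 = p" by auto
    thus "chi w (t * (t + 1)) = 0" by (intro chi_dvd) simp
  qed auto
  also have "\<dots> = (\<Sum>t\<in>?A. w ^ ?k t)"
  proof (rule sum.cong[OF refl])
    fix t assume "t \<in> ?A"
    hence "\<not> p dvd t" "\<not> p dvd t + 1" by (auto intro!: unit_not_dvd simp del: One_nat_def)
    hence "\<not> p dvd t * (t + 1)" using prime_p by (simp only: prime_dvd_mult_iff simp_thms)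
    thus "chi w (t * (t + 1)) = w ^ ?k t" by (simp only: chi_def if_False)
  qed
  also have "\<dots> = (\<Sum>i<3. \<Sum>t\<in>{t\<in>?A. ?k t = i}. w ^ ?k t)"
    by (rule sum.group[symmetric]) (use cls_less_3 in auto)
  also have "\<dots> = (\<Sum>i<3. of_nat (jacobi_coeff i) * w ^ i)" by (simp add: jacobi_coeff_def)
  also have "\<dots> = of_nat (jacobi_coeff 0) + of_nat (jacobi_coeff 1) * w + of_nat (jacobi_coeff 2) * w\<^sup>2"
    by (simp add: numeral_3_eq_3 numeral_2_eq_2)
  finally show ?thesis .
qed

lemma eisenstein_norm:
  fixes w :: "'b :: field"
  assumes "w\<^sup>2 + w + 1 = 0"
  shows "4 * ((x + y * w + u * w\<^sup>2) * (x + y * w\<^sup>2 + u * w)) = (2 * x - y - u)\<^sup>2 + 3 * (y - u)\<^sup>2"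
  using assms by Groebner_Basis.algebra

text \<open>
  Over the complex numbers the relation $J \overline{J} = p$ becomes an identity between
  integers once $J$ is expressed by its coefficients.
\<close>

lemma four_p_eq_norm_form:
  "4 * int p = (2 * int (jacobi_coeff 0) - int (jacobi_coeff 1) - int (jacobi_coeff 2))\<^sup>2 + 3 * (int (jacobi_coeff 1) - int (jacobi_coeff 2))\<^sup>2"
proof -
  obtain w :: complex where w: "w ^ 3 = 1" "w \<noteq> 1"
    using nontrivial_root_of_unity_exists[of 3, where 'a = complex] by auto
  obtain z :: complex where z: "z ^ p = 1" "z \<noteq> 1"
    using nontrivial_root_of_unity_exists[of p, where 'a = complex] p_gt_1 by auto
  interpret cubic_gauss p c w z
    by unfold_locales (use w z p_gt_1 in auto)
  have "(w - 1) * (w\<^sup>2 + w + 1) = 0" using w_cube by (simp add: power2_eq_square power3_eq_cube algebra_simps)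
  hence w0: "w\<^sup>2 + w + 1 = 0" using w_neq_1 by simp
  obtain a b d where abd: "a = int (jacobi_coeff 0)" "b = int (jacobi_coeff 1)" "d = int (jacobi_coeff 2)" by blast
  have "of_int (4 * int p) = 4 * (jacobi_sum w * jacobi_sum (w\<^sup>2))" by (simp add: jacobi_norm)
  also have "\<dots> = of_int ((2 * a - b - d)\<^sup>2 + 3 * (b - d)\<^sup>2)"
    unfolding jacobi_sum_eq_coeffs[OF w_cube] jacobi_sum_eq_coeffs[OF w2(1)] w2_square
    using eisenstein_norm[OF w0, of "of_nat (jacobi_coeff 0)" "of_nat (jacobi_coeff 1)" "of_nat (jacobi_coeff 2)"]
    by (simp add: abd)
  finally show ?thesis unfolding abd by (simp only: of_int_eq_iff)
qed

end

section \<open>Characteristic 7\<close>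

typedef seven = "{0..<7 :: nat}"
  by (rule exI[of _ 0]) simp

instance seven :: prime_card
proof
  have "CARD(seven) = 7"
    using type_definition.card[OF type_definition_seven] by simp
  thus "prime CARD(seven)" by simp
qed

type_synonym gf7_closure = "seven mod_ring alg_closure"

lemma CHAR_gf7_closure: "CHAR(gf7_closure) = 7"
  using type_definition.card[OF type_definition_seven] by simp

lemma of_nat_gf7_closure_eq_iff:
  "(of_nat x :: gf7_closure) = of_nat y \<longleftrightarrow> [x = y] (mod 7)"
  unfolding of_nat_eq_iff_cong_CHAR CHAR_gf7_closure ..

text \<open>
  The character of 7 and the Jacobi sum lie in the prime field, because $\omega = 2$ does. So
  \<open>chi_7_eq_jacobi\<close> is a congruence modulo 7, and $\chi(7)^2 = 1$ singles out the class 0.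
\<close>

lemma (in cubic_class) cls_7_eq_0_iff:
  assumes "p \<noteq> 7"
  shows "cls 7 = 0 \<longleftrightarrow> [((jacobi_coeff 0 + jacobi_coeff 1 * 2 + jacobi_coeff 2 * 4) * p)\<^sup>2 = 1] (mod 7)"
proof -
  have p7: "\<not> p dvd 7" "\<not> 7 dvd p"
    using assms prime_p primes_dvd_imp_eq[of p 7] primes_dvd_imp_eq[of 7 p] by auto
  have p0: "(of_nat p :: gf7_closure) \<noteq> 0"
    using p7 of_nat_gf7_closure_eq_iff[of p 0] by (simp add: cong_0_iff)
  obtain z :: gf7_closure where z: "z ^ p = 1" "z \<noteq> 1"
    using nontrivial_root_of_unity_exists[of p, where 'a = gf7_closure] p_gt_1 p0 by auto
  have two: "(2 :: gf7_closure) ^ 3 = 1" "(2 :: gf7_closure) \<noteq> 1"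
    using of_nat_gf7_closure_eq_iff[of "2 ^ 3" 1] of_nat_gf7_closure_eq_iff[of 2 1]
    by (simp_all add: cong_def)
  interpret cubic_gauss p c 2 z
    by unfold_locales (use two z p0 in auto)
  have "(chi (2 :: gf7_closure) 7)\<^sup>2 = of_nat ((2 ^ cls 7)\<^sup>2)"
    using p7 by (simp add: chi_def)
  moreover have "(jacobi_sum (2 :: gf7_closure) * of_nat p)\<^sup>2
      = of_nat (((jacobi_coeff 0 + jacobi_coeff 1 * 2 + jacobi_coeff 2 * 4) * p)\<^sup>2)"
    by (simp add: jacobi_sum_eq_coeffs[OF two(1)])
  ultimately have "[(2 ^ cls 7)\<^sup>2 = ((jacobi_coeff 0 + jacobi_coeff 1 * 2 + jacobi_coeff 2 * 4) * p)\<^sup>2] (mod 7)"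
    unfolding of_nat_gf7_closure_eq_iff[symmetric]
    using chi_7_eq_jacobi[OF CHAR_gf7_closure] by (simp only:)
  moreover have "cls 7 = 0 \<longleftrightarrow> [(2 ^ cls 7)\<^sup>2 = (1 :: nat)] (mod 7)"
  proof -
    have "cls 7 \<in> {0, 1, 2}" using cls_less_3[of 7] by auto
    thus ?thesis by (auto simp: cong_def)
  qed
  ultimately show ?thesis by (simp only: cong_def)
qed

text \<open>
  If 7 divides $L$ or $M$, then the left-hand side is a sixth power of a unit modulo 7. That the
  value 1 occurs in no other case is checked on the residues.
\<close>

lemma sixth_power_form_mod_7:
  fixes L M :: int
  assumes "\<not> 7 dvd L\<^sup>2 - M\<^sup>2"
  shows "[((L + M) * (L\<^sup>2 - M\<^sup>2))\<^sup>2 = 1] (mod 7) \<longleftrightarrow> 7 dvd L * M"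
proof -
  have *: "\<forall>l\<in>{0,1,2,3,4,5,6::int}. \<forall>m\<in>{0,1,2,3,4,5,6::int}. (l\<^sup>2 - m\<^sup>2) mod 7 \<noteq> 0 \<longrightarrow>
     (((l + m) * (l\<^sup>2 - m\<^sup>2))\<^sup>2 mod 7 = 1 mod 7 \<longleftrightarrow> l * m mod 7 = 0)"
    by simp
  define l m where "l = L mod 7" and "m = M mod 7"
  have lm: "[l = L] (mod 7)" "[m = M] (mod 7)" by (simp_all add: l_def m_def)
  have "l \<in> {0,1,2,3,4,5,6}" "m \<in> {0,1,2,3,4,5,6}" by (auto simp: l_def m_def)
  note * = *[rule_format, OF this]
  have sq: "[l\<^sup>2 - m\<^sup>2 = L\<^sup>2 - M\<^sup>2] (mod 7)" using lm by (intro cong_diff cong_pow)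
  hence "[((l + m) * (l\<^sup>2 - m\<^sup>2))\<^sup>2 = ((L + M) * (L\<^sup>2 - M\<^sup>2))\<^sup>2] (mod 7)"
    using lm by (intro cong_pow cong_mult cong_add)
  moreover have "[l * m = L * M] (mod 7)" using lm by (rule cong_mult)
  ultimately show ?thesis using * sq assms by (simp only: cong_def dvd_eq_mod_eq_0 not_False_eq_True)
qed

text \<open>
  Jacobi's criterion. Let $J$ be the Jacobi sum with 2 in place of $\omega$, and let $(L', M')$ be
  the representation of $4 p$ that comes from its coefficients. Modulo 7 one has $27 \equiv -1$
  and $2 J \equiv L' + M'$, so $J p \equiv (L' + M')(L'^2 - M'^2)$. The given $L$ and $M$ agree
  with $L'$ and $M'$ up to sign.
\<close>

theorem seven_cubic_residue_iff:
  fixes p :: nat and L M :: int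
  assumes p: "prime p" "3 dvd p - 1" "p \<noteq> 7"
    and LM: "4 * int p = L\<^sup>2 + 27 * M\<^sup>2"
  shows "[7 ^ ((p - 1) div 3) = 1] (mod p) \<longleftrightarrow> 7 dvd L * M"
proof -
  have "p \<in> cyclic_moduli"
  proof (cases "p = 2")
    case False
    hence "odd p" using p(1) primes_dvd_imp_eq two_is_prime_nat by blast
    thus ?thesis using p(1) unfolding cyclic_moduli_def
      by (intro UnI1 UnI2 CollectI exI[of _ p] exI[of _ 1] conjI) auto
  qed (simp add: cyclic_moduli_def)
  then obtain c where "residue_primroot p c" using residue_primroot_iff_in_cyclic_moduli by auto
  then interpret cubic_class p c using p by unfold_locales
  have p7: "\<not> p dvd 7" "\<not> 7 dvd int p"
    using p primes_dvd_imp_eq[of p 7] primes_dvd_imp_eq[of 7 p] int_dvd_int_iff[of 7 p] by auto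
  define a b d where "a = int (jacobi_coeff 0)" and "b = int (jacobi_coeff 1)" and "d = int (jacobi_coeff 2)"
  have "3 dvd b - d"
    using three_dvd_jacobi_coeff[of 1] three_dvd_jacobi_coeff[of 2] by (auto simp: b_def d_def intro!: dvd_diff; presburger)
  then obtain M' where M': "b - d = 3 * M'" by (auto elim: dvdE)
  define L' where "L' = 2 * a - b - d"
  have LM': "4 * int p = L'\<^sup>2 + 27 * M'\<^sup>2"
    using four_p_eq_norm_form
    unfolding L'_def a_def[symmetric] b_def[symmetric] d_def[symmetric] M' by simp
  have sq: "(L * M)\<^sup>2 = (L' * M')\<^sup>2"
    using norm_form_27_unique[OF p(1) LM LM'] by (simp add: power_mult_distrib)
  define J where "J = a + b * 2 + d * 4"
  have J: "2 * J = L' + 15 * M' + 14 * d" using M' by (simp add: J_def L'_def)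
  have "8 * (J * int p) = (2 * J) * (4 * int p)" by simp
  also have "\<dots> = (L' + 15 * M' + 14 * d) * (L'\<^sup>2 + 27 * M'\<^sup>2)" unfolding J LM' ..
  finally have eq: "8 * (J * int p) = (L' + 15 * M' + 14 * d) * (L'\<^sup>2 + 27 * M'\<^sup>2)" .
  \<comment> \<open>The factor 8 makes $2 J$ and $4 p$ available and is 1 modulo 7.\<close>
  have "[8 * (J * int p) = 1 * (J * int p)] (mod 7)" by (intro cong_mult) (auto simp: cong_def)
  moreover have "[(L' + 15 * M' + 14 * d) * (L'\<^sup>2 + 27 * M'\<^sup>2) = (L' + M') * (L'\<^sup>2 - M'\<^sup>2)] (mod 7)"
    by (intro cong_mult) (auto simp: cong_iff_dvd_diff algebra_simps)
  ultimately have Jp: "[J * int p = (L' + M') * (L'\<^sup>2 - M'\<^sup>2)] (mod 7)"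
    unfolding eq by (simp only: cong_def mult_1)
  have nd: "\<not> 7 dvd L'\<^sup>2 - M'\<^sup>2"
  proof
    assume "7 dvd L'\<^sup>2 - M'\<^sup>2"
    hence "7 dvd (L'\<^sup>2 - M'\<^sup>2) + 7 * (4 * M'\<^sup>2)" by (intro dvd_add) auto
    also have "(L'\<^sup>2 - M'\<^sup>2) + 7 * (4 * M'\<^sup>2) = 4 * int p" unfolding LM' by simp
    finally have "7 dvd 4 * int p" .
    moreover have "7 dvd 4 * y \<Longrightarrow> 7 dvd y" for y :: int by presburger
    ultimately show False using p7 by blast
  qed
  have "[7 ^ ((p - 1) div 3) = 1] (mod p) \<longleftrightarrow> [((jacobi_coeff 0 + jacobi_coeff 1 * 2 + jacobi_coeff 2 * 4) * p)\<^sup>2 = 1] (mod 7)"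
    using euler_cubic_criterion[OF p7(1)] cls_7_eq_0_iff[OF p(3)] by simp
  also have "\<dots> \<longleftrightarrow> [(J * int p)\<^sup>2 = 1] (mod 7)"
    unfolding cong_int_iff[symmetric] J_def a_def b_def d_def by simp
  also have "\<dots> \<longleftrightarrow> [((L' + M') * (L'\<^sup>2 - M'\<^sup>2))\<^sup>2 = 1] (mod 7)"
    using cong_pow[OF Jp, of 2] by (simp only: cong_def)
  also have "\<dots> \<longleftrightarrow> 7 dvd L' * M'" by (rule sixth_power_form_mod_7[OF nd])
  also have "\<dots> \<longleftrightarrow> 7 dvd L * M"
  proof -
    have "prime (7 :: int)" by simp
    thus ?thesis using sq by (metis prime_dvd_power_iff zero_less_numeral)
  qed
  finally show ?thesis .
qed

section \<open>The witness 7\<close>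

lemma valid_pocklington_witness_iff:
  assumes p: "prime p" and "\<not> p dvd w"
  shows "valid_pocklington_witness p q (int w) \<longleftrightarrow> \<not> [w ^ ((p - 1) div q) = 1] (mod p)"
proof -
  have "[w ^ (p - 1) = 1] (mod p)" using assms by (rule fermat_theorem)
  hence "[int w ^ (p - 1) = 1] (mod int p)"
    using cong_int_iff[of "w ^ (p - 1)" 1 p] by simp
  moreover have "int p dvd int w ^ ((p - 1) div q) - 1 \<longleftrightarrow> [w ^ ((p - 1) div q) = 1] (mod p)"
    unfolding cong_int_iff[symmetric] cong_iff_dvd_diff of_nat_power of_nat_1 ..
  moreover have "gcd y (int p) = 1 \<longleftrightarrow> \<not> int p dvd y" for y
  proof (cases "int p dvd y")
    case True
    hence "gcd y (int p) = int p" by (simp add: gcd_proj2_if_dvd)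
    thus ?thesis using True prime_gt_1_nat[OF p] by simp
  next
    case False
    hence "coprime (int p) y" using p by (intro prime_imp_coprime) auto
    thus ?thesis using False by (simp add: coprime_iff_gcd_eq_1 gcd.commute)
  qed
  ultimately show ?thesis unfolding valid_pocklington_witness_def by simp
qed

text \<open>
  Modulo 7 the orders of 2 and 3 are 3 and 6, so only the exponents modulo 3 and 6 matter.
\<close>

lemma two_three_power_cong_3_mod_7_iff:
  "[2 ^ a * 3 ^ b = (3 :: nat)] (mod 7) \<longleftrightarrow> (a mod 3, b mod 6) \<in> {(0, 1), (1, 5), (2, 3)}"
proof -
  have "(2 :: nat) ^ a = (2 ^ 3) ^ (a div 3) * 2 ^ (a mod 3)"
    unfolding power_mult[symmetric] power_add[symmetric] by simp
  also have "[\<dots> = 1 ^ (a div 3) * 2 ^ (a mod 3)] (mod 7)"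
    by (intro cong_mult cong_pow cong_refl) (simp add: cong_def)
  finally have a: "[2 ^ a = (2 :: nat) ^ (a mod 3)] (mod 7)" by simp
  have "(3 :: nat) ^ b = (3 ^ 6) ^ (b div 6) * 3 ^ (b mod 6)"
    unfolding power_mult[symmetric] power_add[symmetric] by simp
  also have "[\<dots> = 1 ^ (b div 6) * 3 ^ (b mod 6)] (mod 7)"
    by (intro cong_mult cong_pow cong_refl) (simp add: cong_def)
  finally have "[3 ^ b = (3 :: nat) ^ (b mod 6)] (mod 7)" by simp
  with a have "[2 ^ a * 3 ^ b = 2 ^ (a mod 3) * (3 :: nat) ^ (b mod 6)] (mod 7)"
    by (rule cong_mult)
  hence *: "[2 ^ a * 3 ^ b = (3 :: nat)] (mod 7) \<longleftrightarrow> [2 ^ (a mod 3) * 3 ^ (b mod 6) = (3 :: nat)] (mod 7)"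
    by (simp only: cong_def)
  have "a mod 3 \<in> {0, 1, 2}" "b mod 6 \<in> {0, 1, 2, 3, 4, 5}" by auto
  thus ?thesis unfolding * by (elim insertE emptyE) (simp_all add: cong_def)
qed

theorem theorem4p5:
  fixes a b m p :: nat
  assumes "a \<ge> 1" and "b \<ge> 1"
    and "m = 2 ^ a * 3 ^ b - 1"
    and "p = 3 * m * (m + 1) + 1"
    and "prime p"
  shows "(valid_pocklington_witness p 3 7 \<longleftrightarrow> \<not> [m = 2] (mod 7))
    \<and> (\<not> [m = 2] (mod 7) \<longleftrightarrow> (a mod 3, b mod 6) \<notin> {(0, 1), (1, 5), (2, 3)})"
proof -
  define N :: nat where "N = 2 ^ a * 3 ^ (b - 1)"
  have "(3 :: nat) ^ b = 3 * 3 ^ (b - 1)" using assms(2) by (cases b) auto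
  hence N: "2 ^ a * 3 ^ b = 3 * N" by (simp add: N_def)
  have "N \<ge> 1" by (simp add: N_def)
  hence m: "m + 1 = 3 * N" "m \<ge> 2" using assms(3) N by auto
  have "3 * m * (m + 1) \<ge> 3 * 2 * (2 + 1)" using m(2) by (intro mult_mono) auto
  hence p7: "p > 7" using assms(4) by simp
  have nd: "\<not> p dvd 7" using p7 by (auto dest: dvd_imp_le)
  \<comment> \<open>Of the three ways to write $4 p$ as $x^2 + 3 y^2$ with $x, y > 0$, namely with
    $y = m$, $m + 1$ or $2 m + 1$, the one with $3 \mid y$ is $y = m + 1 = 3 N$.\<close>
  have "4 * int p = (3 * int m + 1)\<^sup>2 + 27 * (int N)\<^sup>2"
  proof -
    have "4 * int p = (3 * int m + 1)\<^sup>2 + 3 * (int (m + 1))\<^sup>2"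
      unfolding assms(4) by (simp add: power2_eq_square algebra_simps)
    thus ?thesis unfolding m(1) by (simp add: power2_eq_square)
  qed
  hence crit: "[7 ^ ((p - 1) div 3) = 1] (mod p) \<longleftrightarrow> 7 dvd (3 * int m + 1) * int N"
    using p7 assms(4) by (intro seven_cubic_residue_iff[OF assms(5)]) auto
  have "\<not> 7 dvd N"
  proof
    have pr: "prime (7 :: nat)" by simp
    assume "7 dvd N"
    hence "(7 :: nat) dvd 2 \<or> (7 :: nat) dvd 3"
      unfolding N_def using pr by (metis prime_dvd_mult_iff prime_dvd_power)
    thus False by simp
  qed
  hence "\<not> 7 dvd int N" by presburger
  moreover have "prime (7 :: int)" by simp
  ultimately have "7 dvd (3 * int m + 1) * int N \<longleftrightarrow> 7 dvd 3 * int m + 1"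
    by (metis prime_dvd_mult_iff)
  also have "\<dots> \<longleftrightarrow> [m = 2] (mod 7)"
  proof -
    have "7 dvd 3 * x + 1 \<longleftrightarrow> 7 dvd x - 2" for x :: int by presburger
    thus ?thesis using cong_int_iff[of m 2 7] by (simp add: cong_iff_dvd_diff)
  qed
  finally have "valid_pocklington_witness p 3 7 \<longleftrightarrow> \<not> [m = 2] (mod 7)"
    using valid_pocklington_witness_iff[OF assms(5) nd, of 3] crit by simp
  moreover have "[m = 2] (mod 7) \<longleftrightarrow> [2 ^ a * 3 ^ b = (3 :: nat)] (mod 7)"
    unfolding N m(1)[symmetric]
    using cong_add_rcancel_nat[of m 1 2 7] by simp
  ultimately show ?thesis by (simp only: two_three_power_cong_3_mod_7_iff)
qed

end
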